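(* Let $n \geq 1$ and let $X \subseteq \mathbb{R}^n$ be a pointed closed convex set. Then $X$ is equal to the intersection of all rational closed halfspaces of $\mathbb{R}^n$ that contain $X$.
   Context: $\langle \cdot,\cdot\rangle$ denotes the standard inner product on $\mathbb{R}^n$. A rational closed halfspace is a subset of $\mathbb{R}^n$ of the form $\{x \in \mathbb{R}^n : \langle a, x\rangle \leq \beta\}$ for some $a \in \mathbb{Q}^n \setminus \{0\}$ and $\beta \in \mathbb{Q}$. A closed convex set is pointed if it contains no line, i.e., no set of the form $\{x + t d : t \in \mathbb{R}\}$ with $x, d \in \mathbb{R}^n$ and $d \neq 0$; in particular, the empty set is a pointed closed convex set. *)

theory Defs
  imports "HOL-Analysis.Analysis"
begin

definition rational_closed_halfspace :: "(real ^ 'n) set \<Rightarrow> bool" where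
  "rational_closed_halfspace H \<longleftrightarrow>
     (\<exists>(a :: real ^ 'n) \<beta>. (\<forall>i. a $ i \<in> \<rat>) \<and> a \<noteq> 0 \<and> \<beta> \<in> \<rat> \<and> H = {x. a \<bullet> x \<le> \<beta>})"

(* Closedness and convexity are not part of this predicate. *)
definition pointed :: "'a :: real_vector set \<Rightarrow> bool" where
  "pointed X \<longleftrightarrow> \<not> (\<exists>x d. d \<noteq> 0 \<and> {x + t *\<^sub>R d | t :: real. True} \<subseteq> X)"

end

theory Submission
  imports Defs
begin

text \<open>
  Write \<open>X\<close> as the intersection of the closed halfspaces containing it. A halfspace
  \<open>a \<bullet> x \<le> \<beta>\<close> that separates \<open>X\<close> from a point \<open>y\<close> may have an irrational normal
  \<open>a\<close>, and tilting it slightly can destroy the inclusion of \<open>X\<close>, because \<open>X\<close> may be unbounded.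
  Pointedness provides room for the tilt: it yields a vector \<open>c\<close> and \<open>\<delta> > 0\<close> such that
  \<open>c \<bullet> x + \<delta> * norm x\<close> is bounded above on \<open>X\<close>
  (\<open>pointed_imp_functional_dominating_norm\<close>). Replacing \<open>a\<close> by
  \<open>a + \<epsilon> c\<close> with small \<open>\<epsilon> > 0\<close> keeps \<open>y\<close> strictly separated, and afterwards every
  normal within distance \<open>\<epsilon> \<delta>\<close> is still bounded on \<open>X\<close>, with a common bound. Some of these
  normals are rational.

  The vector \<open>c\<close> comes from the barrier cone, the set of all \<open>b\<close> such that \<open>b \<bullet> x\<close> is bounded above
  on \<open>X\<close>. A nonzero \<open>d\<close> orthogonal to the barrier cone would be the direction of a line
  inside \<open>X\<close>, because no functional in the barrier cone changes along \<open>d\<close>. Hence the barrier cone of a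
  pointed set spans the space, and \<open>c\<close> is the sum of a basis contained in it.
\<close>

definition barrier_cone :: "'a::real_inner set \<Rightarrow> 'a set" where
  "barrier_cone X = {b. \<exists>m. \<forall>x\<in>X. b \<bullet> x \<le> m}"

text \<open>
  The normal of a halfspace that separates \<open>X\<close> from a putative point \<open>x + t d\<close> outside \<open>X\<close> lies in
  the barrier cone, so it takes the same value at \<open>x + t d\<close> as at \<open>x\<close>, which is impossible.
\<close>

lemma line_subset_if_orthogonal_to_barrier_cone:
  fixes X :: "'a::euclidean_space set"
  assumes "closed X" "convex X" "x \<in> X"
    and orth: "\<And>b. b \<in> barrier_cone X \<Longrightarrow> b \<bullet> d = 0"
  shows "x + t *\<^sub>R d \<in> X"
proof (rule ccontr)
  assume "x + t *\<^sub>R d \<notin> X"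
  then obtain a \<beta> where a: "a \<bullet> (x + t *\<^sub>R d) < \<beta>" "\<forall>z\<in>X. \<beta> < a \<bullet> z"
    using separating_hyperplane_closed_point[OF assms(2,1)] by blast
  have "- a \<in> barrier_cone X"
    unfolding barrier_cone_def using a(2) by (auto intro!: exI[of _ "- \<beta>"] less_imp_le)
  then have "a \<bullet> d = 0"
    using orth by fastforce
  with a \<open>x \<in> X\<close> show False
    by (auto simp: inner_right_distrib)
qed

lemma pointed_imp_span_barrier_cone:
  fixes X :: "'a::euclidean_space set"
  assumes "closed X" "convex X" "pointed X" "X \<noteq> {}"
  shows "span (barrier_cone X) = UNIV"
proof (rule ccontr)
  assume "span (barrier_cone X) \<noteq> UNIV"
  then obtain d where d: "d \<noteq> 0" "\<forall>b \<in> span (barrier_cone X). d \<bullet> b = 0"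
    using span_not_UNIV_orthogonal by blast
  obtain x where "x \<in> X"
    using \<open>X \<noteq> {}\<close> by blast
  have "b \<bullet> d = 0" if "b \<in> barrier_cone X" for b
    using d(2) span_base[OF that] by (simp add: inner_commute)
  then have "{x + t *\<^sub>R d | t :: real. True} \<subseteq> X"
    using line_subset_if_orthogonal_to_barrier_cone[OF assms(1,2) \<open>x \<in> X\<close>] by blast
  with d(1) \<open>pointed X\<close> show False
    unfolding pointed_def by blast
qed

text \<open>
  The right-hand side is a norm in \<open>x\<close>, because only \<open>0\<close> is orthogonal to a spanning set; all norms
  on a finite-dimensional space are equivalent.
\<close>

lemma norm_le_sum_abs_inner_spanning:
  fixes S :: "'a::euclidean_space set"
  assumes "finite S" "span S = UNIV"
  obtains \<delta> where "\<delta> > 0" "\<And>x. \<delta> * norm x \<le> (\<Sum>b\<in>S. \<bar>b \<bullet> x\<bar>)"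
proof -
  let ?f = "\<lambda>x. \<Sum>b\<in>S. \<bar>b \<bullet> x\<bar>"
  have "continuous_on (sphere 0 1) ?f"
    by (intro continuous_intros)
  moreover have "sphere (0::'a) 1 \<noteq> {}"
    by simp
  ultimately obtain u where u: "u \<in> sphere 0 1" "\<forall>v\<in>sphere 0 1. ?f u \<le> ?f v"
    using continuous_attains_inf[OF compact_sphere] by blast
  have "?f u \<noteq> 0"
  proof
    assume "?f u = 0"
    then have "\<forall>b\<in>S. orthogonal u b"
      using \<open>finite S\<close> by (simp add: sum_nonneg_eq_0_iff orthogonal_def inner_commute)
    then have "orthogonal u u"
      using orthogonal_to_span[of u S u] \<open>span S = UNIV\<close> by auto
    with u(1) show False
      by (simp add: orthogonal_def)
  qed
  moreover have "?f u \<ge> 0"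
    by (simp add: sum_nonneg)
  ultimately have pos: "?f u > 0"
    by linarith
  have "?f u * norm x \<le> ?f x" for x
  proof (cases "x = 0")
    case False
    have "?f u \<le> ?f (x /\<^sub>R norm x)"
      using False by (intro u(2)[rule_format]) simp
    also have "\<dots> = ?f x / norm x"
      by (simp add: abs_mult divide_inverse mult.commute flip: sum_distrib_left)
    finally show ?thesis
      using False by (simp add: pos_le_divide_eq)
  qed simp
  with pos show thesis
    using that by blast
qed

text \<open>
  On \<open>X\<close> a functional bounded above by \<open>m\<close> satisfies \<open>\<bar>u\<bar> \<le> 2 \<bar>m\<bar> - u\<close>. Adding this over a basis
  inside the barrier cone bounds the norm of \<open>x\<close> by a constant minus a linear functional.
\<close>

lemma pointed_imp_functional_dominating_norm:
  fixes X :: "'a::euclidean_space set"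
  assumes "closed X" "convex X" "pointed X" "X \<noteq> {}"
  obtains c \<delta> M where "\<delta> > 0" "\<And>x. x \<in> X \<Longrightarrow> c \<bullet> x + \<delta> * norm x \<le> M"
proof -
  obtain S where S: "S \<subseteq> barrier_cone X" "independent S" "barrier_cone X \<subseteq> span S"
    using maximal_independent_subset by blast
  have "finite S"
    using S(2) by (rule independent_imp_finite)
  have "span S = UNIV"
    using pointed_imp_span_barrier_cone[OF assms] span_mono[OF S(3)] by (simp add: span_span top.extremum_unique)
  with \<open>finite S\<close> obtain \<delta> where \<delta>: "\<delta> > 0" "\<And>x. \<delta> * norm x \<le> (\<Sum>b\<in>S. \<bar>b \<bullet> x\<bar>)"
    using norm_le_sum_abs_inner_spanning by blast
  have "\<forall>b\<in>S. \<exists>m. \<forall>x\<in>X. b \<bullet> x \<le> m"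
    using S(1) by (auto simp: barrier_cone_def)
  then obtain m where m: "\<And>b x. b \<in> S \<Longrightarrow> x \<in> X \<Longrightarrow> b \<bullet> x \<le> m b"
    by metis
  have "(\<Sum>b\<in>S. b) \<bullet> x + \<delta> * norm x \<le> (\<Sum>b\<in>S. 2 * \<bar>m b\<bar>)" if "x \<in> X" for x
  proof -
    have "(\<Sum>b\<in>S. \<bar>b \<bullet> x\<bar>) \<le> (\<Sum>b\<in>S. 2 * \<bar>m b\<bar> - b \<bullet> x)"
      using m[OF _ that] by (intro sum_mono) fastforce
    then show ?thesis
      using \<delta>(2)[of x] by (simp add: sum_subtractf inner_sum_left)
  qed
  with \<delta>(1) show thesis
    using that by blast
qed

lemma rational_vector_approximation:
  fixes a :: "real ^ 'n"
  assumes "e > 0"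
  obtains r where "\<And>i. r $ i \<in> \<rat>" "norm (r - a) < e"
proof -
  define e' where "e' = e / real CARD('n)"
  have "e' > 0"
    using assms by (simp add: e'_def)
  then have "\<forall>i. \<exists>q\<in>\<rat>. \<bar>q - a $ i\<bar> < e'"
    using rational_approximation[of e'] by metis
  then obtain q where q: "\<And>i. q i \<in> \<rat>" "\<And>i. \<bar>q i - a $ i\<bar> < e'"
    by metis
  define r where "r = (\<chi> i. q i)"
  have "norm (r - a) \<le> (\<Sum>i\<in>UNIV. \<bar>q i - a $ i\<bar>)"
    using norm_le_l1_cart[of "r - a"] by (simp add: r_def)
  also have "\<dots> < (\<Sum>i\<in>(UNIV::'n set). e')"
    using q(2) by (intro sum_strict_mono) auto
  also have "\<dots> = e"
    by (simp add: e'_def)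
  finally show thesis
    using that[of r] q(1) by (simp add: r_def)
qed

lemma rational_separation_of_point_from_pointed:
  fixes X :: "(real ^ 'n) set"
  assumes "closed X" "convex X" "pointed X" "X \<noteq> {}" "y \<notin> X"
  obtains H where "rational_closed_halfspace H" "X \<subseteq> H" "y \<notin> H"
proof -
  obtain a \<beta> where a: "\<And>x. x \<in> X \<Longrightarrow> a \<bullet> x \<le> \<beta>" "\<beta> < a \<bullet> y"
  proof -
    obtain a' \<beta>' where "a' \<bullet> y < \<beta>'" "\<forall>x\<in>X. \<beta>' < a' \<bullet> x"
      using separating_hyperplane_closed_point[OF assms(2,1,5)] by blast
    then show thesis
      using that[of "- a'" "- \<beta>'"] by (auto intro: less_imp_le)
  qed
  obtain c \<delta> M where c: "\<delta> > 0" "\<And>x. x \<in> X \<Longrightarrow> c \<bullet> x + \<delta> * norm x \<le> M"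
    using pointed_imp_functional_dominating_norm[OF assms(1-4)] by metis
  \<comment> \<open>\<open>L\<close> strictly bounds the rate at which the separation gap at \<open>y\<close> shrinks as \<open>\<epsilon>\<close> grows.\<close>
  define L where "L = \<bar>M - c \<bullet> y + \<delta> * norm y\<bar> + 1"
  define \<epsilon> where "\<epsilon> = (a \<bullet> y - \<beta>) / L"
  have "L > 0"
    by (simp add: L_def)
  then have "\<epsilon> > 0" and \<epsilon>L: "\<epsilon> * L = a \<bullet> y - \<beta>"
    using a(2) by (auto simp: \<epsilon>_def)
  obtain r where r: "\<And>i. r $ i \<in> \<rat>" "norm (r - (a + \<epsilon> *\<^sub>R c)) < \<epsilon> * \<delta>"
    using rational_vector_approximation[of "\<epsilon> * \<delta>"] \<open>\<epsilon> > 0\<close> c(1) by auto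
  define w where "w = r - (a + \<epsilon> *\<^sub>R c)"
  have w: "\<bar>w \<bullet> x\<bar> \<le> \<epsilon> * (\<delta> * norm x)" for x
  proof -
    have "\<bar>w \<bullet> x\<bar> \<le> norm w * norm x"
      by (rule Cauchy_Schwarz_ineq2)
    also have "\<dots> \<le> (\<epsilon> * \<delta>) * norm x"
      using r(2) by (intro mult_right_mono) (auto simp: w_def)
    finally show ?thesis
      by (simp add: mult.assoc)
  qed
  have r_inner: "r \<bullet> x = a \<bullet> x + \<epsilon> * (c \<bullet> x) + w \<bullet> x" for x
    by (simp add: w_def inner_diff_left inner_add_left)
  have upper: "r \<bullet> x \<le> \<beta> + \<epsilon> * M" if "x \<in> X" for x
  proof -
    have "\<epsilon> * (c \<bullet> x + \<delta> * norm x) \<le> \<epsilon> * M"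
      using c(2)[OF that] \<open>\<epsilon> > 0\<close> by simp
    then show ?thesis
      using a(1)[OF that] w[of x] r_inner[of x] by (simp add: distrib_left)
  qed
  have lower: "\<beta> + \<epsilon> * M < r \<bullet> y"
  proof -
    have "\<epsilon> * (M - c \<bullet> y + \<delta> * norm y) < \<epsilon> * L"
      using \<open>\<epsilon> > 0\<close> by (simp add: L_def)
    then show ?thesis
      using \<epsilon>L w[of y] r_inner[of y] by (simp add: distrib_left right_diff_distrib)
  qed
  obtain q where q: "q \<in> \<rat>" "\<beta> + \<epsilon> * M < q" "q < r \<bullet> y"
    using Rats_dense_in_real[OF lower] by blast
  have "r \<noteq> 0"
    using \<open>X \<noteq> {}\<close> upper lower by fastforce
  show thesis
  proof (rule that)
    show "rational_closed_halfspace {x. r \<bullet> x \<le> q}"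
      unfolding rational_closed_halfspace_def using r(1) q(1) \<open>r \<noteq> 0\<close> by blast
    show "X \<subseteq> {x. r \<bullet> x \<le> q}"
      using upper q(2) by fastforce
    show "y \<notin> {x. r \<bullet> x \<le> q}"
      using q(3) by simp
  qed
qed

text \<open>
  The empty set needs separate treatment, as the barrier cone argument starts from a point of \<open>X\<close>:
  here a translate of any coordinate halfspace excludes \<open>y\<close>.
\<close>

lemma ex_rational_closed_halfspace_not_containing:
  fixes y :: "real ^ 'n"
  obtains H where "rational_closed_halfspace H" "y \<notin> H"
proof -
  fix k :: 'n
  obtain q where q: "q \<in> \<rat>" "q < y $ k"
    using Rats_dense_in_real[of "y $ k - 1" "y $ k"] by auto
  have "rational_closed_halfspace {x. axis k 1 \<bullet> x \<le> q}"
    unfolding rational_closed_halfspace_def using q(1)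
    by (intro exI[of _ "axis k 1"] exI[of _ q]) (auto simp: axis_def vec_eq_iff)
  moreover have "y \<notin> {x. axis k 1 \<bullet> x \<le> q}"
    using q(2) by (simp add: inner_axis')
  ultimately show thesis
    using that by blast
qed

theorem theorem3:
  fixes X :: "(real ^ 'n) set"
  assumes "closed X" and "convex X" and "pointed X"
  shows "X = \<Inter> {H. rational_closed_halfspace H \<and> X \<subseteq> H}"
proof
  show "X \<subseteq> \<Inter> {H. rational_closed_halfspace H \<and> X \<subseteq> H}"
    by blast
  show "\<Inter> {H. rational_closed_halfspace H \<and> X \<subseteq> H} \<subseteq> X"
  proof (rule subsetI, rule ccontr)
    fix y
    assume y: "y \<in> \<Inter> {H. rational_closed_halfspace H \<and> X \<subseteq> H}" and "y \<notin> X"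
    obtain H where "rational_closed_halfspace H" "X \<subseteq> H" "y \<notin> H"
    proof (cases "X = {}")
      case True
      then show thesis
        using that ex_rational_closed_halfspace_not_containing[of y] by blast
    next
      case False
      then show thesis
        using that rational_separation_of_point_from_pointed[OF assms _ \<open>y \<notin> X\<close>] by blast
    qed
    with y show False
      by blast
  qed
qed

end
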